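(* Let $G=(V,E)$ be a directed graph on $n$ vertices and $m$ edges with positive real capacities, a designated source vertex $s$ and a designated sink vertex $t$. There is a rooted tree $T_{\mathfrak{B}}$ for $G$ occupying $\mathcal{O}(n)$ space such that, given any pair of distinct vertices $u,v$ of $G$, $T_{\mathfrak{B}}$ can report in $\mathcal{O}(1)$ time the capacity of an $(s,t)$-cut of least capacity among all $(s,t)$-cuts separating $u$ and $v$.
   Context: An $(s,t)$-cut is a set $C\subset V$ with $s\in C$, $t\notin C$; its capacity is the total capacity of edges from $C$ to $V\setminus C$. An $(s,t)$-cut $C$ separates $u$ and $v$ if exactly one of $u,v$ belongs to $C$. *)

theory Defs
  imports Complex_Main "Graph_Theory.Digraph"
begin

section \<open>Cuts\<close>

definition st_network :: "('a, 'b) pre_digraph \<Rightarrow> ('b \<Rightarrow> real) \<Rightarrow> 'a \<Rightarrow> 'a \<Rightarrow> bool" where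
  "st_network G cap s t \<longleftrightarrow>
     fin_digraph G \<and> (\<forall>e \<in> arcs G. cap e > 0) \<and> s \<in> verts G \<and> t \<in> verts G \<and> s \<noteq> t"

definition st_cut :: "('a, 'b) pre_digraph \<Rightarrow> 'a \<Rightarrow> 'a \<Rightarrow> 'a set \<Rightarrow> bool" where
  "st_cut G s t C \<longleftrightarrow> C \<subseteq> verts G \<and> s \<in> C \<and> t \<notin> C"

definition cut_capacity :: "('a, 'b) pre_digraph \<Rightarrow> ('b \<Rightarrow> real) \<Rightarrow> 'a set \<Rightarrow> real" where
  "cut_capacity G cap C = (\<Sum>e | e \<in> arcs G \<and> tail G e \<in> C \<and> head G e \<in> verts G - C. cap e)"

definition separates :: "'a set \<Rightarrow> 'a \<Rightarrow> 'a \<Rightarrow> bool" where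
  "separates C u v \<longleftrightarrow> (u \<in> C) \<noteq> (v \<in> C)"


section \<open>Rooted trees as data structures\<close>

definition rooted_tree :: "'v set \<Rightarrow> 'v \<Rightarrow> ('v \<Rightarrow> 'v) \<Rightarrow> bool" where
  "rooted_tree N r par \<longleftrightarrow>
     finite N \<and> r \<in> N \<and> par r = r \<and> (\<forall>x \<in> N. par x \<in> N) \<and> (\<forall>x \<in> N. \<exists>k. (par ^^ k) x = r)"

text \<open>
  A stored tree has the nodes \<open>0, \<dots>, tsize T - 1\<close>. The record of a node consists of its
  parent pointer (the root points to itself), further machine words and real numbers.
  The data structure is made up of these records and a pointer to the root, nothing else.
\<close>

record stored_tree =
  tsize :: nat
  troot :: nat
  tparent :: "nat \<Rightarrow> nat"
  twords :: "nat \<Rightarrow> nat list"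
  treals :: "nat \<Rightarrow> real list"

text \<open>Space is the number of memory cells, each holding one word or one real number.\<close>

definition space :: "stored_tree \<Rightarrow> nat" where
  "space T = 1 + (\<Sum>x < tsize T. 1 + length (twords T x) + length (treals T x))"

text \<open>
  \<open>stores_tree w n T\<close>: \<open>T\<close> is a rooted tree, all of whose pointers and words fit into \<open>w\<close> bits
  (so that a real cell is the only kind of cell with unbounded content), and
  nodes \<open>0, \<dots>, n - 1\<close> represent the \<open>n\<close> vertices of the graph.
\<close>

definition stores_tree :: "nat \<Rightarrow> nat \<Rightarrow> stored_tree \<Rightarrow> bool" where
  "stores_tree w n T \<longleftrightarrow>
     rooted_tree {..<tsize T} (troot T) (tparent T) \<and>
     n \<le> tsize T \<and> tsize T \<le> 2 ^ w \<and>
     (\<forall>x < tsize T. \<forall>a \<in> set (twords T x). a < 2 ^ w)"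


section \<open>The query machine\<close>

text \<open>
  Queries run on a unit-cost word RAM with \<open>w\<close>-bit words, with random access to
  the node records. Real numbers can only be loaded, compared and reported; there is no
  rounding or other way to extract words from them.
\<close>

datatype word_op = Add | Sub | Mul | Div | Mod | And | Or | Xor | Shl | Shr

fun word_op_sem :: "nat \<Rightarrow> word_op \<Rightarrow> nat \<Rightarrow> nat \<Rightarrow> nat" where
  "word_op_sem w Add a b = take_bit w (a + b)"
| "word_op_sem w Sub a b = take_bit w (a + 2 ^ w - b)"
| "word_op_sem w Mul a b = take_bit w (a * b)"
| "word_op_sem w Div a b = a div b"
| "word_op_sem w Mod a b = a mod b"
| "word_op_sem w And a b = semiring_bit_operations_class.and a b"
| "word_op_sem w Or a b = semiring_bit_operations_class.or a b"
| "word_op_sem w Xor a b = semiring_bit_operations_class.xor a b"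
| "word_op_sem w Shl a b = take_bit w (push_bit b a)"
| "word_op_sem w Shr a b = drop_bit b a"

text \<open>
  Arguments are register numbers, except for the constant of \<open>Const\<close>, the field index (last
  argument) of \<open>LoadWord\<close> and \<open>LoadReal\<close>, and the jump targets (last argument of the jumps).
  Word and real registers are separate; the destination comes first. The second argument of the
  load instructions is the word register holding the node to be accessed.
\<close>

datatype instr =
    Const nat nat
  | Op word_op nat nat nat
  | LoadParent nat nat
  | LoadWord nat nat nat
  | LoadReal nat nat nat
  | JumpLess nat nat nat
  | JumpEq nat nat nat
  | JumpLessReal nat nat nat
  | Report nat

text \<open>
  \<open>run P w T k pc W R\<close> executes at most \<open>k\<close> instructions of the program \<open>P\<close> from position \<open>pc\<close>
  with word registers \<open>W\<close> and real registers \<open>R\<close>. The result is \<open>Some x\<close> if the run reports the real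
  number \<open>x\<close> within this budget, and \<open>None\<close> if the budget is exhausted or the run fails
  by leaving the program or accessing a node or field that does not exist.
\<close>

fun run :: "instr list \<Rightarrow> nat \<Rightarrow> stored_tree \<Rightarrow> nat \<Rightarrow> nat \<Rightarrow> (nat \<Rightarrow> nat) \<Rightarrow> (nat \<Rightarrow> real) \<Rightarrow> real option"
where
  "run P w T 0 pc W R = None"
| "run P w T (Suc k) pc W R =
     (if pc \<ge> length P then None
      else case P ! pc of
        Const d a \<Rightarrow> run P w T k (Suc pc) (W(d := take_bit w a)) R
      | Op f d i j \<Rightarrow> run P w T k (Suc pc) (W(d := word_op_sem w f (W i) (W j))) R
      | LoadParent d i \<Rightarrow>
          (if W i < tsize T then run P w T k (Suc pc) (W(d := tparent T (W i))) R else None)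
      | LoadWord d i f \<Rightarrow>
          (if W i < tsize T \<and> f < length (twords T (W i))
           then run P w T k (Suc pc) (W(d := twords T (W i) ! f)) R else None)
      | LoadReal d i f \<Rightarrow>
          (if W i < tsize T \<and> f < length (treals T (W i))
           then run P w T k (Suc pc) W (R(d := treals T (W i) ! f)) else None)
      | JumpLess i j l \<Rightarrow> run P w T k (if W i < W j then l else Suc pc) W R
      | JumpEq i j l \<Rightarrow> run P w T k (if W i = W j then l else Suc pc) W R
      | JumpLessReal i j l \<Rightarrow> run P w T k (if R i < R j then l else Suc pc) W R
      | Report i \<Rightarrow> Some (R i))"

text \<open>A query gets the two vertex numbers and the root pointer in word registers 0, 1 and 2.\<close>

definition query :: "instr list \<Rightarrow> nat \<Rightarrow> stored_tree \<Rightarrow> nat \<Rightarrow> nat \<Rightarrow> nat \<Rightarrow> real option" where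
  "query P w T k i j = run P w T k 0 ((\<lambda>_. 0)(0 := i, 1 := j, 2 := troot T)) (\<lambda>_. 0)"

text \<open>Words have logarithmically many bits; \<open>c\<close> is the constant factor.\<close>

definition word_size :: "nat \<Rightarrow> nat \<Rightarrow> nat" where
  "word_size c n = c * nat \<lceil>log 2 (real n)\<rceil>"

end

theory Submission
  imports Defs "HOL-Library.Discrete_Functions"
begin

text \<open>
  A cut separating \<open>x\<close> from \<open>z\<close> also separates \<open>x\<close> from \<open>y\<close> or \<open>y\<close> from \<open>z\<close>, so the least
  capacities \<open>c x y\<close> of separating cuts satisfy \<open>min (c x y) (c y z) \<le> c x z\<close>. Hence the vertices can
  be put in an order in which \<open>c x z = min (c x y) (c y z)\<close> whenever \<open>y\<close> lies between \<open>x\<close> and \<open>z\<close>: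
  queries become range minima.

  Put the vertices at the leaves of a complete binary tree in heap numbering and split the
  range from \<open>p\<close> to \<open>q\<close> at the midpoint of the lowest common ancestor. As one ascends from
  \<open>p\<close>, the minimum over the positions from \<open>p\<close> to the right end of the current block
  changes at a level only to the minimum over the right half of the block at that level. So it
  suffices to store one minimum per half block, and for each leaf a bit mask of the levels where
  the two agree; the relevant level is the highest masked bit below the ancestor, found by a
  table lookup. The side of \<open>q\<close> is symmetric.
\<close>

section \<open>Ordering an ultrametric\<close>

text \<open>All pairs across a suitable partition into two parts have the overall minimum value, so
  the parts can be ordered recursively and concatenated. \<open>ultra\<close> speaks of distinct
  points only because the cut value of a vertex with itself is unspecified.\<close>

lemma ultrametric_ordering:
  fixes c :: "'a \<Rightarrow> 'a \<Rightarrow> 'r :: linorder"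
  assumes "finite S"
    and sym: "\<And>x y. c x y = c y x"
    and ultra: "\<And>x y z. x \<in> S \<Longrightarrow> y \<in> S \<Longrightarrow> z \<in> S \<Longrightarrow> x \<noteq> y \<Longrightarrow> y \<noteq> z \<Longrightarrow> x \<noteq> z \<Longrightarrow>
      min (c x y) (c y z) \<le> c x z"
  shows "\<exists>pos. bij_betw pos S {..<card S} \<and>
    (\<forall>x\<in>S. \<forall>y\<in>S. \<forall>z\<in>S. pos x < pos y \<longrightarrow> pos y < pos z \<longrightarrow> c x z = min (c x y) (c y z))"
  using assms(1) ultra
proof (induction S rule: finite_psubset_induct)
  case (psubset S)
  show ?case
  proof (cases "\<exists>x\<in>S. \<exists>y\<in>S. x \<noteq> y")
    case False
    obtain pos where pos: "bij_betw pos S {..<card S}"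
      using \<open>finite S\<close> by (metis atLeast0LessThan ex_bij_betw_finite_nat)
    moreover have "\<not> pos x < pos y" if "x \<in> S" "y \<in> S" for x y
      using False that by (metis less_irrefl)
    ultimately show ?thesis by blast
  next
    case True
    \<comment> \<open>Split \<open>S\<close> so that all values across attain the overall minimum, and put one part first.\<close>
    define V where "V = (\<lambda>(x, y). c x y) ` {(x, y). x \<in> S \<and> y \<in> S \<and> x \<noteq> y}"
    have "finite V"
      unfolding V_def
      by (rule finite_imageI, rule finite_subset[of _ "S \<times> S"]) (use \<open>finite S\<close> in auto)
    moreover have "V \<noteq> {}" using True by (auto simp: V_def)
    ultimately have "Min V \<in> V" and Min_le: "\<And>v. v \<in> V \<Longrightarrow> Min V \<le> v" by auto
    then obtain a b where ab: "a \<in> S" "b \<in> S" "a \<noteq> b" "c a b = Min V" by (auto simp: V_def)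
    have least: "c a b \<le> c x y" if "x \<in> S" "y \<in> S" "x \<noteq> y" for x y
      unfolding ab(4) by (rule Min_le) (use that in \<open>auto simp: V_def\<close>)
    \<comment> \<open>The open ball around \<open>a\<close>; \<open>a\<close> itself is added by
      hand since nothing is known about \<open>c a a\<close>.\<close>
    define A where "A = {x \<in> S. x = a \<or> c a x > c a b}"
    define B where "B = S - A"
    have S: "S = A \<union> B" "A \<inter> B = {}" "A \<subset> S" "B \<subset> S"
      using ab by (auto simp: A_def B_def)
    have fin: "finite A" "finite B" using S \<open>finite S\<close> by (auto intro: finite_subset)
    have card: "card S = card A + card B" using S(1,2) fin by (metis card_Un_disjoint)
    have cross: "c x y = c a b" if "x \<in> A" "y \<in> B" for x y
    proof (rule antisym)
      have xy: "x \<in> S" "y \<in> S" "x \<noteq> y" "y \<noteq> a" "c a y \<le> c a b" "x = a \<or> c a b < c a x"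
        using that by (auto simp: A_def B_def)
      show "c a b \<le> c x y" using least xy by blast
      \<comment> \<open>If this failed for \<open>x \<noteq> a\<close>, then \<open>c a x\<close>
        and \<open>c x y\<close> would both exceed the minimum, hence so would \<open>c a y\<close>,
        putting \<open>y\<close> into \<open>A\<close>.\<close>
      show "c x y \<le> c a b"
      proof (cases "x = a")
        case False
        then have "min (c a x) (c x y) \<le> c a y" using psubset.prems[of a x y] ab xy by auto
        then show ?thesis using xy False by (auto simp: min_def split: if_splits)
      qed (use xy in auto)
    qed
    have IH: "\<exists>pos. bij_betw pos T {..<card T} \<and> (\<forall>x\<in>T. \<forall>y\<in>T. \<forall>z\<in>T.
        pos x < pos y \<longrightarrow> pos y < pos z \<longrightarrow> c x z = min (c x y) (c y z))" if "T \<subset> S" for T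
      by (rule psubset.IH[OF that], rule psubset.prems) (use that in auto)
    obtain pA where pA: "bij_betw pA A {..<card A}"
      "\<And>x y z. x\<in>A \<Longrightarrow> y\<in>A \<Longrightarrow> z\<in>A \<Longrightarrow> pA x < pA y \<Longrightarrow> pA y < pA z \<Longrightarrow> c x z = min (c x y) (c y z)"
      using IH[OF S(3)] by blast
    obtain pB where pB: "bij_betw pB B {..<card B}"
      "\<And>x y z. x\<in>B \<Longrightarrow> y\<in>B \<Longrightarrow> z\<in>B \<Longrightarrow> pB x < pB y \<Longrightarrow> pB y < pB z \<Longrightarrow> c x z = min (c x y) (c y z)"
      using IH[OF S(4)] by blast
    define pos where "pos = (\<lambda>x. if x \<in> A then pA x else card A + pB x)"
    have posA: "pos x = pA x" "pA x < card A" if "x \<in> A" for x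
      using that pA(1) by (auto simp: pos_def bij_betw_def)
    have posB: "pos x = card A + pB x" if "x \<in> B" for x
      using that S(2) by (auto simp: pos_def)
    have "bij_betw pos A {..<card A}"
      using pA(1) posA by (simp cong: bij_betw_cong)
    moreover have "bij_betw pos B {card A..<card A + card B}"
    proof -
      have "bij_betw ((+) (card A)) {..<card B} {card A..<card A + card B}"
        by (simp add: bij_betw_def lessThan_atLeast0 add.commute)
      from bij_betw_trans[OF pB(1) this] show ?thesis
        using posB by (simp add: o_def cong: bij_betw_cong)
    qed
    ultimately have "bij_betw pos (A \<union> B) ({..<card A} \<union> {card A..<card A + card B})"
      by (rule bij_betw_combine) auto
    moreover have "{..<card A} \<union> {card A..<card A + card B} = {..<card S}"
      using card by auto
    ultimately have "bij_betw pos S {..<card S}" using S(1) by simp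
    moreover have "c x z = min (c x y) (c y z)"
      if xyz: "x \<in> S" "y \<in> S" "z \<in> S" "pos x < pos y" "pos y < pos z" for x y z
    proof (cases "z \<in> A")
      case True
      then have "pos z < card A" using posA by simp
      then have "y \<notin> B" "x \<notin> B" using posB[of x] posB[of y] xyz(4,5) by linarith+
      then have "y \<in> A" "x \<in> A" using xyz S(1) by auto
      then show ?thesis using True xyz pA(2) posA(1) by simp
    next
      case zB: False
      then have zB: "z \<in> B" using xyz S by auto
      show ?thesis
      proof (cases "x \<in> A")
        case True
        \<comment> \<open>One of the two steps from \<open>x\<close> via \<open>y\<close> to
          \<open>z\<close> crosses from \<open>A\<close> to \<open>B\<close> and attains the
          minimum.\<close>
        have le: "c a b \<le> c x y" "c a b \<le> c y z" using least xyz by blast+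
        have "c x y = c a b \<or> c y z = c a b"
          using cross[OF True, of y] cross[OF _ zB, of y] xyz(2) S(1) by blast
        then show ?thesis using le cross[OF True zB] by (auto simp: min_def)
      next
        case False
        then have xB: "x \<in> B" using xyz S by auto
        then have "y \<in> B"
          using xyz(2,4) S(1) posA[of y] posB[OF xB] by auto
        then show ?thesis using xB zB xyz pB(2) posB by simp
      qed
    qed
    ultimately show ?thesis by blast
  qed
qed

section \<open>Range minima by dyadic blocks\<close>

lemma drop_bit_floor_log:
  assumes "x > 0"
  shows "drop_bit (floor_log x) x = 1"
  unfolding drop_bit_eq_div
  by (rule div_nat_eqI) (use floor_log_exp2_le[OF assms] floor_log_exp2_gt[of x] in auto)

lemma xor_nat_eq_0_iff: "xor p q = 0 \<longleftrightarrow> p = q" for p q :: nat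
  by (auto simp: bit_eq_iff bit_xor_iff)

lemma floor_log_div_power: "floor_log (x div 2 ^ j) = floor_log x - j"
  by (induction j) (simp_all add: power_Suc2 div_mult2_eq del: power_Suc)

definition level_mask :: "nat \<Rightarrow> (nat \<Rightarrow> bool) \<Rightarrow> nat" where
  "level_mask h Q = horner_sum of_bool 2 (map Q [0..<h])"

lemma bit_level_mask: "bit (level_mask h Q) j \<longleftrightarrow> j < h \<and> Q j"
  by (auto simp: level_mask_def bit_horner_sum_bit_iff)

lemma level_mask_less: "level_mask h Q < 2 ^ h"
  using horner_sum_of_bool_2_less[of "map Q [0..<h]", where 'a = nat] by (simp add: level_mask_def)

text \<open>This turns the search for the highest level up to \<open>k\<close> with \<open>Q\<close>
  into word operations: \<open>mask (Suc k)\<close> removes the levels above \<open>k\<close>, and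
  \<open>Q 0\<close> keeps the masked word nonzero.\<close>

lemma floor_log_masked_level:
  fixes k :: nat
  assumes "k < h" "Q 0"
  defines "j \<equiv> floor_log (and (level_mask h Q) (mask (Suc k)))"
  shows "Q j" "j \<le> k" "\<And>i. j < i \<Longrightarrow> i \<le> k \<Longrightarrow> \<not> Q i"
proof -
  define x where "x = and (level_mask h Q) (mask (Suc k))"
  have bit: "bit x i \<longleftrightarrow> i \<le> k \<and> Q i" for i
    using assms(1) by (auto simp: x_def bit_and_iff bit_level_mask bit_mask_iff)
  have "bit x 0" using assms(2) bit by blast
  then have "x > 0" by (intro gr0I) simp
  then have drop: "drop_bit j x = 1" unfolding j_def x_def[symmetric] by (rule drop_bit_floor_log)
  have shift: "bit x (j + i) \<longleftrightarrow> i = 0" for i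
    using drop by (metis bit_drop_bit_eq comp_apply bit_1_iff)
  from shift[of 0] show "Q j" "j \<le> k" by (simp_all add: bit)
  show "\<not> Q i" if "j < i" "i \<le> k" for i
    using shift[of "i - j"] that by (simp add: bit)
qed

text \<open>
  The node \<open>x\<close> at level \<open>j\<close> above the leaves \<open>2 ^ h, \<dots>, 2 ^ Suc h - 1\<close> covers the leaves from
  \<open>x * 2 ^ j\<close> up to but excluding \<open>(x + 1) * 2 ^ j\<close>. At level 0 the left half is
  empty and the right half is the whole block.
\<close>

definition left_half :: "(nat \<Rightarrow> nat \<Rightarrow> 'r) \<Rightarrow> nat \<Rightarrow> nat \<Rightarrow> 'r" where
  "left_half M h x = (let j = h - floor_log x in M (x * 2 ^ j) ((2 * x + 1) * 2 ^ j div 2))"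

definition right_half :: "(nat \<Rightarrow> nat \<Rightarrow> 'r) \<Rightarrow> nat \<Rightarrow> nat \<Rightarrow> 'r" where
  "right_half M h x = (let j = h - floor_log x in M ((2 * x + 1) * 2 ^ j div 2) ((x + 1) * 2 ^ j))"

definition left_mask :: "(nat \<Rightarrow> nat \<Rightarrow> 'r) \<Rightarrow> nat \<Rightarrow> nat \<Rightarrow> nat" where
  "left_mask M h q =
     level_mask h (\<lambda>j. M (q div 2 ^ j * 2 ^ j) q = left_half M h (q div 2 ^ j))"

definition right_mask :: "(nat \<Rightarrow> nat \<Rightarrow> 'r) \<Rightarrow> nat \<Rightarrow> nat \<Rightarrow> nat" where
  "right_mask M h p =
     level_mask h (\<lambda>j. M p ((p div 2 ^ j + 1) * 2 ^ j) = right_half M h (p div 2 ^ j))"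

text \<open>\<open>M a b\<close> stands for a minimum over the gaps between positions
  \<open>a\<close> and \<open>b\<close>, so adjoining ranges share an endpoint. The case
  \<open>a = m\<close> forces empty ranges to be neutral.\<close>

locale interval_min =
  fixes M :: "nat \<Rightarrow> nat \<Rightarrow> 'r :: linorder"
  assumes split: "\<And>a m b. a \<le> m \<Longrightarrow> m \<le> b \<Longrightarrow> M a b = min (M a m) (M m b)"
begin

text \<open>On ascending from a left child, the range grows by the right half of the parent's block,
  so its minimum stays or becomes that of the half. A right child ends where its parent
  ends.\<close>

lemma level_step_right:
  assumes "Suc j \<le> h" "floor_log p = h"
    and "M p ((p div 2 ^ Suc j + 1) * 2 ^ Suc j) \<noteq> right_half M h (p div 2 ^ Suc j)"
  shows "M p ((p div 2 ^ Suc j + 1) * 2 ^ Suc j) = M p ((p div 2 ^ j + 1) * 2 ^ j)"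
proof -
  define y where "y = p div 2 ^ j"
  have x: "p div 2 ^ Suc j = y div 2"
    by (simp add: y_def power_Suc2 div_mult2_eq del: power_Suc)
  have r: "right_half M h (y div 2) = M ((2 * (y div 2) + 1) * 2 ^ j) ((y div 2 + 1) * 2 ^ Suc j)"
  proof -
    have "floor_log (y div 2) = h - Suc j" using x floor_log_div_power[of p "Suc j"] assms(2) by simp
    \<comment> \<open>Above level 0 the halving in the midpoint is exact.\<close>
    moreover have "(2 * (y div 2) + 1) * 2 ^ Suc j div 2 = (2 * (y div 2) + 1) * 2 ^ j"
      by (metis mult.left_commute nonzero_mult_div_cancel_left power_Suc zero_neq_numeral)
    ultimately show ?thesis using assms(1) by (simp only: right_half_def Let_def diff_diff_cancel)
  qed
  show ?thesis
  proof (cases "even y")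
    case True
    then have y: "2 * (y div 2) = y" by simp
    have "p < (y + 1) * 2 ^ j"
      unfolding y_def using dividend_less_div_times[of "2 ^ j" p] by (simp add: algebra_simps)
    moreover have "(y + 1) * 2 ^ j \<le> (y div 2 + 1) * 2 ^ Suc j"
    proof -
      have "(y + 1) * 2 ^ j \<le> (2 * (y div 2 + 1)) * 2 ^ j"
        using y by (intro mult_right_mono) auto
      then show ?thesis by (simp add: mult_ac)
    qed
    ultimately have "M p ((y div 2 + 1) * 2 ^ Suc j) =
        min (M p ((y + 1) * 2 ^ j)) (right_half M h (y div 2))"
      unfolding r y by (intro split) auto
    then show ?thesis using assms(3) unfolding x y_def[symmetric]
      by (auto simp: min_def split: if_splits)
  next
    case False
    then have "2 * (y div 2 + 1) = y + 1" by presburger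
    then have "(y div 2 + 1) * 2 ^ Suc j = (y + 1) * 2 ^ j"
      by (metis mult.assoc mult.commute power_Suc)
    then show ?thesis unfolding x y_def[symmetric] by (simp only:)
  qed
qed

text \<open>Mirror image: only a right child gains anything, namely the left half of its parent's
  block.\<close>

lemma level_step_left:
  assumes "Suc j \<le> h" "floor_log q = h"
    and "M (q div 2 ^ Suc j * 2 ^ Suc j) q \<noteq> left_half M h (q div 2 ^ Suc j)"
  shows "M (q div 2 ^ Suc j * 2 ^ Suc j) q = M (q div 2 ^ j * 2 ^ j) q"
proof -
  define y where "y = q div 2 ^ j"
  have x: "q div 2 ^ Suc j = y div 2"
    by (simp add: y_def power_Suc2 div_mult2_eq del: power_Suc)
  have r: "left_half M h (y div 2) = M (y div 2 * 2 ^ Suc j) ((2 * (y div 2) + 1) * 2 ^ j)"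
  proof -
    have "floor_log (y div 2) = h - Suc j" using x floor_log_div_power[of q "Suc j"] assms(2) by simp
    moreover have "(2 * (y div 2) + 1) * 2 ^ Suc j div 2 = (2 * (y div 2) + 1) * 2 ^ j"
      by (metis mult.left_commute nonzero_mult_div_cancel_left power_Suc zero_neq_numeral)
    ultimately show ?thesis using assms(1) by (simp only: left_half_def Let_def diff_diff_cancel)
  qed
  show ?thesis
  proof (cases "even y")
    case True
    then have "y div 2 * 2 ^ Suc j = y * 2 ^ j" by simp
    then show ?thesis unfolding x y_def[symmetric] by (simp only:)
  next
    case False
    then have y: "2 * (y div 2) + 1 = y" by presburger
    have "y * 2 ^ j \<le> q" by (simp add: y_def)
    moreover have "y div 2 * 2 ^ Suc j \<le> y * 2 ^ j"
      using mult_right_mono[of "2 * (y div 2)" y "2 ^ j"] by (simp add: mult_ac)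
    ultimately have "M (y div 2 * 2 ^ Suc j) q = min (left_half M h (y div 2)) (M (y * 2 ^ j) q)"
      unfolding r y by (intro split) auto
    then show ?thesis using assms(3) unfolding x y_def[symmetric]
      by (auto simp: min_def split: if_splits)
  qed
qed

text \<open>By \<open>level_step_right\<close> the value does not change from the highest marked
  level up to \<open>k\<close>, and the mark says that at its level the value is the stored one.
  Level 0 is always marked.\<close>

lemma right_mask_lookup:
  assumes p: "floor_log p = h" and k: "k < h"
  shows "right_half M h (p div 2 ^ floor_log (and (right_mask M h p) (mask (Suc k))))
    = M p ((p div 2 ^ k + 1) * 2 ^ k)"
proof -
  define Q where "Q = (\<lambda>j. M p ((p div 2 ^ j + 1) * 2 ^ j) = right_half M h (p div 2 ^ j))"
  define j where "j = floor_log (and (level_mask h Q) (mask (Suc k)))"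
  have "Q 0" using p by (simp add: Q_def right_half_def)
  from floor_log_masked_level[of k h Q, OF k this, folded j_def]
  have j: "Q j" "j \<le> k" "\<And>i. j < i \<Longrightarrow> i \<le> k \<Longrightarrow> \<not> Q i" by auto
  have "M p ((p div 2 ^ i + 1) * 2 ^ i) = M p ((p div 2 ^ j + 1) * 2 ^ j)" if "j \<le> i" "i \<le> k" for i
    using that
  proof (induction i rule: dec_induct)
    case (step i)
    then have "\<not> Q (Suc i)" using j(3) by simp
    then show ?case using step level_step_right[of i h p] p k unfolding Q_def by auto
  qed simp
  from this[of k] j(1,2) show ?thesis
    unfolding right_mask_def Q_def[symmetric] j_def[symmetric] unfolding Q_def by simp
qed

text \<open>As for the right mask; level 0 is marked because both values there are
  \<open>M q q\<close>.\<close>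

lemma left_mask_lookup:
  assumes q: "floor_log q = h" and k: "k < h"
  shows "left_half M h (q div 2 ^ floor_log (and (left_mask M h q) (mask (Suc k))))
    = M (q div 2 ^ k * 2 ^ k) q"
proof -
  define Q where "Q = (\<lambda>j. M (q div 2 ^ j * 2 ^ j) q = left_half M h (q div 2 ^ j))"
  define j where "j = floor_log (and (level_mask h Q) (mask (Suc k)))"
  have "Q 0" using q by (simp add: Q_def left_half_def)
  from floor_log_masked_level[of k h Q, OF k this, folded j_def]
  have j: "Q j" "j \<le> k" "\<And>i. j < i \<Longrightarrow> i \<le> k \<Longrightarrow> \<not> Q i" by auto
  have "M (q div 2 ^ i * 2 ^ i) q = M (q div 2 ^ j * 2 ^ j) q" if "j \<le> i" "i \<le> k" for i
    using that
  proof (induction i rule: dec_induct)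
    case (step i)
    then have "\<not> Q (Suc i)" using j(3) by simp
    then show ?case using step level_step_left[of i h q] q k unfolding Q_def by auto
  qed simp
  from this[of k] j(1,2) show ?thesis
    unfolding left_mask_def Q_def[symmetric] j_def[symmetric] unfolding Q_def by simp
qed

text \<open>\<open>k\<close> is the highest bit in which \<open>p\<close> and \<open>q\<close>
  differ, so their ancestors at level \<open>k\<close> are siblings, and the boundary between these
  splits the range.\<close>

lemma min_at_split_level:
  fixes p q h :: nat
  assumes "0 < p" "p < q" "floor_log p = h" "floor_log q = h"
  defines "k \<equiv> floor_log (xor p q)"
  shows "k < h" "xor p q < 2 ^ h"
    "M p q = min (M p ((p div 2 ^ k + 1) * 2 ^ k)) (M (q div 2 ^ k * 2 ^ k) q)"
proof -
  have pos: "p > 0" "q > 0" using assms(1,2) by simp_all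
  have x: "xor p q > 0"
    using \<open>p < q\<close> by (simp add: xor_nat_eq_0_iff zero_less_iff_neq_zero)
  \<comment> \<open>Both numbers have leading bit \<open>h\<close>, which the exclusive or
    cancels.\<close>
  have "drop_bit h (xor p q) = 0"
    using drop_bit_floor_log[OF pos(1)] drop_bit_floor_log[OF pos(2)] assms by simp
  then show *: "xor p q < 2 ^ h" by (simp add: drop_bit_eq_div div_eq_0_iff)
  have "2 ^ k \<le> xor p q" unfolding k_def by (rule floor_log_exp2_le[OF x])
  with * have "(2::nat) ^ k < 2 ^ h" by linarith
  then show "k < h" by simp
  have one: "drop_bit k (xor p q) = 1" unfolding k_def by (rule drop_bit_floor_log[OF x])
  have ne: "p div 2 ^ k \<noteq> q div 2 ^ k"
    using one by (auto simp: drop_bit_eq_div[symmetric])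
  have "drop_bit (Suc k) (xor p q) = 0"
    using one by (simp add: drop_bit_eq_div power_Suc2 div_mult2_eq del: power_Suc)
  then have "drop_bit (Suc k) p = drop_bit (Suc k) q"
    by (simp only: drop_bit_xor xor_nat_eq_0_iff)
  then have "p div 2 ^ k div 2 = q div 2 ^ k div 2"
    by (simp add: drop_bit_eq_div power_Suc2 div_mult2_eq del: power_Suc)
  moreover have "p div 2 ^ k \<le> q div 2 ^ k" using \<open>p < q\<close> by (simp add: div_le_mono)
  ultimately have eq: "q div 2 ^ k = p div 2 ^ k + 1" using ne by linarith
  have "p < (p div 2 ^ k + 1) * 2 ^ k"
    using dividend_less_div_times[of "2 ^ k" p] by (simp add: algebra_simps)
  moreover have "q div 2 ^ k * 2 ^ k \<le> q" by simp
  ultimately show "M p q = min (M p ((p div 2 ^ k + 1) * 2 ^ k)) (M (q div 2 ^ k * 2 ^ k) q)"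
    unfolding eq by (intro split) auto
qed

end

section \<open>The stored tree and its query program\<close>

text \<open>Node \<open>x\<close> serves at once as the record of vertex number \<open>x\<close>
  (words 0 to 2), as an entry of the tables that replace a bit scan (words 3 and 4) and as a block
  of the heap (reals). Number 0, which heap numbering leaves free, becomes the root because
  \<open>1 div 2 = 0\<close>.\<close>

definition rmq_tree :: "nat \<Rightarrow> (nat \<Rightarrow> nat) \<Rightarrow> (nat \<Rightarrow> nat \<Rightarrow> real) \<Rightarrow> stored_tree" where
  "rmq_tree h leaf M =
    \<lparr>tsize = 2 ^ Suc h, troot = 0, tparent = (\<lambda>x. x div 2),
     twords = (\<lambda>x. [leaf x, right_mask M h (leaf x), left_mask M h (leaf x),
                    mask (Suc (floor_log x)), floor_log x]),
     treals = (\<lambda>x. [right_half M h x, left_half M h x])\<rparr>"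

text \<open>
  The jump skips the exchange of the vertices, so that the word registers 3 and 4 hold the
  smaller and the larger leaf, 5 and 6 the right mask of the former and the left mask
  of the latter.
\<close>

definition rmq_program :: "instr list" where
  "rmq_program =
    [LoadWord 3 0 0,
     LoadWord 4 1 0,
     LoadWord 5 0 1,
     LoadWord 6 1 2,
     JumpLess 3 4 9,
     LoadWord 3 1 0,
     LoadWord 4 0 0,
     LoadWord 5 1 1,
     LoadWord 6 0 2,
     Op Xor 7 3 4,
     LoadWord 8 7 3,
     Op And 5 5 8,
     LoadWord 5 5 4,
     Op Shr 3 3 5,
     LoadReal 0 3 0,
     Op And 6 6 8,
     LoadWord 6 6 4,
     Op Shr 4 4 6,
     LoadReal 1 4 1,
     JumpLessReal 0 1 21,
     Report 1,
     Report 0]"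

lemma stores_rmq_tree:
  assumes "n \<le> 2 ^ h" "h < w" "\<And>x. leaf x < 2 ^ Suc h"
  shows "stores_tree w n (rmq_tree h leaf M)"
proof -
  have "(2::nat) ^ Suc h \<le> 2 ^ w" using \<open>h < w\<close> by (intro power_increasing) auto
  then have fit: "a < 2 ^ w" if "a < 2 ^ Suc h" for a :: nat using that by linarith
  have iter: "((\<lambda>x. x div 2) ^^ k) x = x div 2 ^ k" for k x :: nat
    by (induction k) (simp_all add: power_Suc2 div_mult2_eq del: power_Suc)
  \<comment> \<open>The witness \<open>x\<close> works since \<open>x < 2 ^ x\<close>.\<close>
  have "\<exists>k. ((\<lambda>x. x div 2) ^^ k) x = 0" for x :: nat
    unfolding iter by (rule exI[of _ x]) simp
  then have "rooted_tree {..<2 ^ Suc h :: nat} 0 (\<lambda>x. x div 2)"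
    by (auto simp: rooted_tree_def intro: le_less_trans[OF div_le_dividend])
  moreover have "a < 2 ^ w" if x: "x < 2 ^ Suc h" and a: "a \<in> set (twords (rmq_tree h leaf M) x)" for x a
  proof -
    have log: "floor_log x \<le> h"
    proof (cases "x = 0")
      case False
      then have "2 ^ floor_log x < (2::nat) ^ Suc h"
        using floor_log_exp2_le[of x] x by linarith
      then show ?thesis by (simp del: power_Suc)
    qed simp
    have "mask (Suc (floor_log x)) < (2::nat) ^ Suc (floor_log x)"
      by (simp add: mask_eq_exp_minus_1)
    also have "\<dots> \<le> 2 ^ Suc h" using log by (intro power_increasing) auto
    finally have "mask (Suc (floor_log x)) < (2::nat) ^ Suc h" .
    moreover have "level_mask h Q < 2 ^ Suc h" for Q
      using level_mask_less[of h Q] by simp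
    moreover have "floor_log x < 2 ^ Suc h"
      using log less_exp[of "Suc h"] by linarith
    ultimately have "a < 2 ^ Suc h"
      using a assms(3) by (auto simp: rmq_tree_def right_mask_def left_mask_def)
    then show ?thesis by (rule fit)
  qed
  ultimately show ?thesis
    using assms(1) \<open>2 ^ Suc h \<le> 2 ^ w\<close> by (auto simp: stores_tree_def rmq_tree_def)
qed

text \<open>Each record has a parent pointer, five words and two reals; the root pointer is the
  extra cell.\<close>

lemma space_rmq_tree: "space (rmq_tree h leaf M) = 1 + 8 * 2 ^ Suc h"
  by (simp add: space_def rmq_tree_def)

text \<open>Unfolds \<open>run\<close> for numeral fuel without turning the numerals into successor terms.\<close>

lemmas run_numeral = run.simps(2)[of _ _ _ "pred_numeral n" for n, folded numeral_eq_Suc]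

text \<open>Symbolic execution on an abstract \<open>T\<close>. The budget 22 is the length of the
  program, which suffices because all jumps go forward.\<close>

lemma query_rmq_program:
  assumes "twords T i ! 0 = p" "twords T i ! 1 = right" "twords T j ! 0 = q" "twords T j ! 2 = left"
    and "i < tsize T" "j < tsize T" "p < q"
    and "xor p q < tsize T" "twords T (xor p q) ! 3 = m"
    and "and right m < tsize T" "twords T (and right m) ! 4 = a" "drop_bit a p < tsize T"
    and "and left m < tsize T" "twords T (and left m) ! 4 = b" "drop_bit b q < tsize T"
    and [simp]: "\<And>x. length (twords T x) = 5" "\<And>x. length (treals T x) = 2"
  defines "result \<equiv> Some (min (treals T (drop_bit a p) ! 0) (treals T (drop_bit b q) ! 1))"
  shows "query rmq_program w T 22 i j = result" "query rmq_program w T 22 j i = result"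
  using assms(1-15) by (simp_all add: query_def rmq_program_def run_numeral result_def)

text \<open>The program performs the two mask lookups at the split level. Beyond their correctness,
  every computed number used as an address must be a node.\<close>

lemma query_rmq_tree:
  assumes "interval_min M"
    and leaf: "\<And>x. floor_log (leaf x) = h" "0 < leaf i" "leaf i < leaf j"
    and ij: "i < 2 ^ Suc h" "j < 2 ^ Suc h"
  shows "query rmq_program w (rmq_tree h leaf M) 22 i j = Some (M (leaf i) (leaf j))"
    "query rmq_program w (rmq_tree h leaf M) 22 j i = Some (M (leaf i) (leaf j))"
proof -
  interpret interval_min M by fact
  define T where "T = rmq_tree h leaf M"
  define p q where "p = leaf i" and "q = leaf j"
  have pq: "0 < p" "p < q" "floor_log p = h" "floor_log q = h"
    using leaf by (auto simp: p_def q_def)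
  define k where "k = floor_log (xor p q)"
  define u where "u = and (right_mask M h p) (mask (Suc k))"
  define v where "v = and (left_mask M h q) (mask (Suc k))"
  note lv = min_at_split_level[OF pq, folded k_def]
  have val: "M p q =
      min (right_half M h (p div 2 ^ floor_log u)) (left_half M h (q div 2 ^ floor_log v))"
    unfolding u_def v_def
    using right_mask_lookup[OF pq(3) lv(1)] left_mask_lookup[OF pq(4) lv(1)] lv(3) by simp
  have "take_bit (Suc k) x < 2 ^ Suc h" for x :: nat
  proof -
    have "take_bit (Suc k) x < 2 ^ Suc k" by (rule take_bit_nat_less_exp)
    also have "\<dots> \<le> 2 ^ Suc h" using lv(1) by (intro power_increasing) auto
    finally show ?thesis .
  qed
  then have uv: "u < 2 ^ Suc h" "v < 2 ^ Suc h"
    by (simp_all only: u_def v_def flip: take_bit_eq_mask)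
  have quot: "drop_bit e x < 2 ^ Suc h" if "floor_log x = h" for x e
    using floor_log_exp2_gt[of x] that
    by (auto simp: drop_bit_eq_div intro: le_less_trans[OF div_le_dividend])
  have xor: "xor p q < 2 ^ Suc h" using lv(2) by simp
  have size: "tsize T = 2 ^ Suc h" by (simp add: T_def rmq_tree_def)
  have words: "twords T x = [leaf x, right_mask M h (leaf x), left_mask M h (leaf x),
      mask (Suc (floor_log x)), floor_log x]" for x
    by (simp add: T_def rmq_tree_def)
  have reals: "treals T x = [right_half M h x, left_half M h x]" for x
    by (simp add: T_def rmq_tree_def)
  have fields: "twords T i ! 0 = p" "twords T i ! 1 = right_mask M h p"
    "twords T j ! 0 = q" "twords T j ! 2 = left_mask M h q"
    "twords T (xor p q) ! 3 = mask (Suc k)" "twords T x ! 4 = floor_log x"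
    "length (twords T x) = 5" "length (treals T x) = 2"
    "treals T x ! 0 = right_half M h x" "treals T x ! 1 = left_half M h x" for x
    by (simp_all add: words reals p_def q_def k_def)
  note result = query_rmq_program[where w = w, OF fields(1-4) ij[folded size] pq(2) xor[folded size]
    fields(5), folded u_def v_def, OF uv(1)[folded size] fields(6) quot[OF pq(3), folded size]
    uv(2)[folded size] fields(6) quot[OF pq(4), folded size] fields(7,8)]
  have "query rmq_program w T 22 i j = Some (M p q)" "query rmq_program w T 22 j i = Some (M p q)"
    unfolding result fields val drop_bit_eq_div by (rule refl)+
  then show "query rmq_program w (rmq_tree h leaf M) 22 i j = Some (M (leaf i) (leaf j))"
    "query rmq_program w (rmq_tree h leaf M) 22 j i = Some (M (leaf i) (leaf j))"
    by (simp_all only: T_def p_def q_def)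
qed

section \<open>Separating cuts\<close>

text \<open>For \<open>u = v\<close> no cut separates, and the value is the unspecified minimum of
  the empty set.\<close>

definition min_cut_value :: "('a, 'b) pre_digraph \<Rightarrow> ('b \<Rightarrow> real) \<Rightarrow> 'a \<Rightarrow> 'a \<Rightarrow> 'a \<Rightarrow> 'a \<Rightarrow> real" where
  "min_cut_value G cap s t u v = Min (cut_capacity G cap ` {C. st_cut G s t C \<and> separates C u v})"

lemma min_cut_value_commute: "min_cut_value G cap s t u v = min_cut_value G cap s t v u"
proof -
  have "separates C u v \<longleftrightarrow> separates C v u" for C by (auto simp: separates_def)
  then show ?thesis by (simp add: min_cut_value_def)
qed

section \<open>Attained minima, the ultrametric inequality and the tree\<close>

context
  fixes G :: "('a, 'b) pre_digraph" and cap s t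
  assumes network: "st_network G cap s t"
begin

lemma finite_cuts: "finite {C. st_cut G s t C \<and> separates C u v}"
proof (rule finite_subset)
  show "{C. st_cut G s t C \<and> separates C u v} \<subseteq> Pow (verts G)" by (auto simp: st_cut_def)
  show "finite (Pow (verts G))"
    using network by (simp add: st_network_def fin_digraph.finite_verts)
qed

lemma min_cut_value_le:
  assumes "st_cut G s t C" "separates C u v"
  shows "min_cut_value G cap s t u v \<le> cut_capacity G cap C"
  unfolding min_cut_value_def using assms finite_cuts by (intro Min_le) auto

text \<open>\<open>{s, u}\<close> is a separating cut unless \<open>u = t\<close> or
  \<open>v = s\<close>; in these cases \<open>{s, v}\<close> is one.\<close>

lemma min_cut_value_attained:
  assumes "u \<in> verts G" "v \<in> verts G" "u \<noteq> v"
  obtains C where "st_cut G s t C" "separates C u v"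
    "cut_capacity G cap C = min_cut_value G cap s t u v"
proof -
  have "\<exists>C. st_cut G s t C \<and> separates C u v"
  proof (cases "u \<noteq> t \<and> v \<noteq> s")
    case True
    then have "st_cut G s t {s, u} \<and> separates {s, u} u v"
      using assms network by (auto simp: st_cut_def separates_def st_network_def)
    then show ?thesis by blast
  next
    case False
    then have "st_cut G s t {s, v} \<and> separates {s, v} u v"
      using assms network by (auto simp: st_cut_def separates_def st_network_def)
    then show ?thesis by blast
  qed
  then have "min_cut_value G cap s t u v \<in> cut_capacity G cap ` {C. st_cut G s t C \<and> separates C u v}"
    unfolding min_cut_value_def using finite_cuts by (intro Min_in) auto
  then show ?thesis using that by auto
qed

lemma min_cut_value_ultrametric:
  assumes "x \<in> verts G" "z \<in> verts G" "x \<noteq> z"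
  shows "min (min_cut_value G cap s t x y) (min_cut_value G cap s t y z) \<le> min_cut_value G cap s t x z"
proof -
  obtain C where C: "st_cut G s t C" "separates C x z"
    "cut_capacity G cap C = min_cut_value G cap s t x z"
    using min_cut_value_attained assms .
  then have "separates C x y \<or> separates C y z" by (auto simp: separates_def)
  then show ?thesis using min_cut_value_le C by (metis min.coboundedI1 min.coboundedI2)
qed

text \<open>\<open>M\<close> is defined on all numbers because the blocks of the heap extend beyond
  the last vertex. The offset \<open>h\<close> will be the number of the first leaf.\<close>

lemma min_cut_values_interval_min:
  obtains pos M where "bij_betw pos (verts G) {..<card (verts G)}" "interval_min M"
    "\<And>u v. u \<in> verts G \<Longrightarrow> v \<in> verts G \<Longrightarrow> pos u < pos v \<Longrightarrow>
      M (h + pos u) (h + pos v) = min_cut_value G cap s t u v"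
proof -
  define V where "V = verts G"
  define n where "n = card V"
  let ?c = "min_cut_value G cap s t"
  have fin: "finite V"
    using network by (simp add: V_def st_network_def fin_digraph.finite_verts)
  have "s \<in> V" using network by (simp add: V_def st_network_def)
  then have "n > 0" using fin by (auto simp: n_def card_gt_0_iff)
  have "\<exists>pos. bij_betw pos V {..<n} \<and> (\<forall>x\<in>V. \<forall>y\<in>V. \<forall>z\<in>V.
      pos x < pos y \<longrightarrow> pos y < pos z \<longrightarrow> ?c x z = min (?c x y) (?c y z))"
    unfolding n_def
    by (rule ultrametric_ordering[OF fin min_cut_value_commute min_cut_value_ultrametric])
      (simp_all add: V_def)
  then obtain pos where pos: "bij_betw pos V {..<n}"
    and mid: "\<And>x y z. x \<in> V \<Longrightarrow> y \<in> V \<Longrightarrow> z \<in> V \<Longrightarrow> pos x < pos y \<Longrightarrow> pos y < pos z \<Longrightarrow>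
      ?c x z = min (?c x y) (?c y z)"
    by blast
  define B where "B = Max ((\<lambda>(x, y). ?c x y) ` (V \<times> V))"
  have B: "?c x y \<le> B" if "x \<in> V" "y \<in> V" for x y
    unfolding B_def using fin that by (intro Max_ge) auto
  \<comment> \<open>Beyond the last vertex positions are clamped; \<open>B\<close> serves as infinity for empty ranges.\<close>
  define e where "e k = min (k - h) (n - 1)" for k
  have e: "e k < n" for k using \<open>n > 0\<close> by (simp add: e_def)
  have e_mono: "e a \<le> e b" if "a \<le> b" for a b using that by (auto simp: e_def)
  define g where "g = inv_into V pos"
  have g: "g i \<in> V" "pos (g i) = i" if "i < n" for i
    using pos that unfolding g_def bij_betw_def
    by (auto intro: inv_into_into f_inv_into_f)
  have g_pos: "g (pos x) = x" if "x \<in> V" for x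
    using pos that unfolding g_def bij_betw_def by simp
  define M where "M a b = (if e a = e b then B else ?c (g (e a)) (g (e b)))" for a b
  have le_B: "M a b \<le> B" for a b using B g e by (simp add: M_def)
  have "interval_min M"
  proof
    fix a m b :: nat
    assume "a \<le> m" "m \<le> b"
    then have "e a \<le> e m" "e m \<le> e b" by (auto intro: e_mono)
    \<comment> \<open>A range collapsed by clamping has the neutral value \<open>B\<close>;
      otherwise the middle position lies strictly between the others and \<open>mid\<close>
      applies.\<close>
    then consider "e a = e m" | "e m = e b" | "e a < e m" "e m < e b" by linarith
    then show "M a b = min (M a m) (M m b)"
    proof cases
      case 1
      then have "M a m = B" "M a b = M m b" by (simp_all add: M_def)
      then show ?thesis using le_B[of m b] by simp
    next
      case 2
      then have "M m b = B" "M a b = M a m" by (simp_all add: M_def)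
      then show ?thesis using le_B[of a m] by simp
    next
      case 3
      then show ?thesis using mid[of "g (e a)" "g (e m)" "g (e b)"] g e by (simp add: M_def)
    qed
  qed
  moreover have "M (h + pos u) (h + pos v) = ?c u v" if "u \<in> V" "v \<in> V" "pos u < pos v" for u v
  proof -
    have "pos u < n" "pos v < n" using pos that by (auto simp: bij_betw_def)
    then have "e (h + pos u) = pos u" "e (h + pos v) = pos v" by (auto simp: e_def)
    then show ?thesis using that g_pos by (simp add: M_def)
  qed
  ultimately show ?thesis using that pos unfolding n_def V_def by blast
qed

lemma exists_min_cut_tree:
  assumes num: "bij_betw num (verts G) {..<n}" and n: "n = card (verts G)"
    and h: "n \<le> 2 ^ h" "h < w" "2 ^ h \<le> 2 * n"
  shows "\<exists>T. stores_tree w n T \<and> space T \<le> 33 * n \<and>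
    (\<forall>u \<in> verts G. \<forall>v \<in> verts G. u \<noteq> v \<longrightarrow>
      (\<exists>C. is_arg_min (cut_capacity G cap) (\<lambda>C. st_cut G s t C \<and> separates C u v) C \<and>
        query rmq_program w T 22 (num u) (num v) = Some (cut_capacity G cap C)))"
proof -
  obtain pos M where pos: "bij_betw pos (verts G) {..<n}" and M: "interval_min M"
    and M_eq: "\<And>u v. u \<in> verts G \<Longrightarrow> v \<in> verts G \<Longrightarrow> pos u < pos v \<Longrightarrow>
      M (2 ^ h + pos u) (2 ^ h + pos v) = min_cut_value G cap s t u v"
    using min_cut_values_interval_min[of "2 ^ h"] n by metis
  \<comment> \<open>\<open>num\<close> is an arbitrary numbering, \<open>pos\<close> the order found
    above. Nodes that represent no vertex get the first leaf, which keeps their words in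
    range.\<close>
  define leaf where
    "leaf x = 2 ^ h + (if x < n then pos (inv_into (verts G) num x) else 0)" for x
  define T where "T = rmq_tree h leaf M"
  have "leaf x < 2 ^ h + 2 ^ h" for x
  proof (cases "x < n")
    case True
    then have "inv_into (verts G) num x \<in> verts G"
      using num by (auto simp: bij_betw_def intro: inv_into_into)
    then have "pos (inv_into (verts G) num x) < n" using pos by (auto simp: bij_betw_def)
    then show ?thesis using h(1) by (simp add: leaf_def)
  qed (simp add: leaf_def)
  then have leaf: "leaf x < 2 ^ Suc h" "2 ^ h \<le> leaf x" for x by (simp_all add: leaf_def)
  have log: "floor_log (leaf x) = h" for x
    by (rule floor_log_eqI) (use leaf[of x] in \<open>auto intro: less_le_trans[OF _ leaf(2)]\<close>)
  have leaf_num: "leaf (num u) = 2 ^ h + pos u" if "u \<in> verts G" for u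
    using num that by (auto simp: leaf_def bij_betw_def)
  have num_less: "num u < 2 ^ Suc h" if "u \<in> verts G" for u
  proof -
    have "num u < n" using num that by (auto simp: bij_betw_def)
    then show ?thesis using h(1) by simp
  qed
  have query: "query rmq_program w T 22 (num u) (num v) = Some (min_cut_value G cap s t u v)"
    if uv: "u \<in> verts G" "v \<in> verts G" "u \<noteq> v" for u v
  proof -
    have less: "query rmq_program w T 22 (num u) (num v) = Some (min_cut_value G cap s t u v) \<and>
        query rmq_program w T 22 (num v) (num u) = Some (min_cut_value G cap s t u v)"
      if "u \<in> verts G" "v \<in> verts G" "pos u < pos v" for u v
      using query_rmq_tree[where leaf = leaf and i = "num u" and j = "num v" and w = w, OF M log] that
      by (simp add: T_def leaf_num M_eq num_less del: power_Suc)
    have "pos u \<noteq> pos v" using pos uv by (auto simp: bij_betw_def inj_on_def)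
    then show ?thesis
      using less[of u v] less[of v u] uv min_cut_value_commute[of G cap s t u v] by fastforce
  qed
  have "stores_tree w n T" unfolding T_def using h leaf by (intro stores_rmq_tree)
  \<comment> \<open>The space is at most \<open>1 + 32 * n\<close>, and \<open>n > 0\<close> absorbs
    the 1.\<close>
  moreover have "space T \<le> 33 * n"
  proof -
    have "n > 0" using network n
      by (auto simp: st_network_def card_gt_0_iff fin_digraph.finite_verts)
    then show ?thesis using h(3) by (simp add: T_def space_rmq_tree)
  qed
  moreover have "\<exists>C. is_arg_min (cut_capacity G cap) (\<lambda>C. st_cut G s t C \<and> separates C u v) C \<and>
      query rmq_program w T 22 (num u) (num v) = Some (cut_capacity G cap C)"
    if uv: "u \<in> verts G" "v \<in> verts G" "u \<noteq> v" for u v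
  proof -
    obtain C where C: "st_cut G s t C" "separates C u v"
      "cut_capacity G cap C = min_cut_value G cap s t u v"
      using min_cut_value_attained uv .
    then have "is_arg_min (cut_capacity G cap) (\<lambda>C. st_cut G s t C \<and> separates C u v) C"
      using min_cut_value_le by (fastforce simp: is_arg_min_def)
    then show ?thesis using query uv C(3) by auto
  qed
  ultimately show ?thesis by blast
qed

end

text \<open>Rounding up adds at most 1 to the logarithm and so at most doubles the power.
  \<open>0 < h\<close> yields \<open>h < 2 * h\<close>, the spare bit that node numbers
  need.\<close>

lemma ceiling_log2_bounds:
  assumes "n \<ge> 2"
  defines "h \<equiv> nat \<lceil>log 2 (real n)\<rceil>"
  shows "n \<le> 2 ^ h" "2 ^ h \<le> 2 * n" "0 < h"
proof -
  have pos: "log 2 (real n) > 0" using assms by simp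
  then have h: "real h = of_int \<lceil>log 2 (real n)\<rceil>" by (simp add: h_def)
  show "0 < h" using pos by (simp add: h_def)
  have "log 2 (real n) \<le> real h" unfolding h by (rule le_of_int_ceiling)
  then have "real n \<le> 2 powr real h" using assms(1) by (subst (asm) log_le_iff) auto
  then have "real n \<le> real (2 ^ h)" by (simp add: powr_realpow)
  then show "n \<le> 2 ^ h" by (simp only: of_nat_le_iff)
  have "real h \<le> log 2 (real n) + 1" unfolding h by linarith
  also have "\<dots> = log 2 (2 * real n)" using assms by (simp add: log_mult)
  finally have "2 powr real h \<le> 2 * real n" using assms(1) by (subst (asm) le_log_iff) auto
  then have "real (2 ^ h) \<le> real (2 * n)" by (simp add: powr_realpow)
  then show "2 ^ h \<le> 2 * n" by (simp only: of_nat_le_iff)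
qed

theorem theorem23:
  shows "\<exists>(P :: instr list) (c_word :: nat) (c_space :: nat) (c_time :: nat).
    \<forall>(G :: ('a, 'b) pre_digraph) (cap :: 'b \<Rightarrow> real) (s :: 'a) (t :: 'a)
      (num :: 'a \<Rightarrow> nat) (n :: nat) (w :: nat).
      st_network G cap s t \<and> n = card (verts G) \<and> bij_betw num (verts G) {..<n} \<and>
      w = word_size c_word n \<longrightarrow>
      (\<exists>T. stores_tree w n T \<and> space T \<le> c_space * n \<and>
        (\<forall>u \<in> verts G. \<forall>v \<in> verts G. u \<noteq> v \<longrightarrow>
          (\<exists>C. is_arg_min (cut_capacity G cap) (\<lambda>C. st_cut G s t C \<and> separates C u v) C \<and>
               query P w T c_time (num u) (num v) = Some (cut_capacity G cap C))))"
proof (rule exI[of _ rmq_program], rule exI[of _ 2], rule exI[of _ 33], rule exI[of _ 22],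
    intro allI impI, elim conjE)
  fix G :: "('a, 'b) pre_digraph" and cap s t num and n w :: nat
  assume network: "st_network G cap s t" and n: "n = card (verts G)"
    and num: "bij_betw num (verts G) {..<n}" and w: "w = word_size 2 n"
  \<comment> \<open>The two distinct vertices \<open>s\<close> and \<open>t\<close> make the
    logarithm of \<open>n\<close> positive.\<close>
  have "card {s, t} \<le> n"
    unfolding n using network by (intro card_mono) (auto simp: st_network_def fin_digraph.finite_verts)
  then have "n \<ge> 2" using network by (simp add: st_network_def)
  note h = ceiling_log2_bounds[OF this]
  show "\<exists>T. stores_tree w n T \<and> space T \<le> 33 * n \<and>
    (\<forall>u \<in> verts G. \<forall>v \<in> verts G. u \<noteq> v \<longrightarrow>
      (\<exists>C. is_arg_min (cut_capacity G cap) (\<lambda>C. st_cut G s t C \<and> separates C u v) C \<and>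
        query rmq_program w T 22 (num u) (num v) = Some (cut_capacity G cap C)))"
    using h by (intro exists_min_cut_tree[OF network num n h(1) _ h(2)]) (simp add: w word_size_def)
qed

end
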